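(* Let $K\ge 1$ and let $M$ be any one of the four instrumental variable models $M_1,M_2,M_3,M_4$ (determined by assumptions (i), (ii), (iii), (iv) respectively). For $i,j\in\{0,1\}$ define, from the observed distributions $P(X,Y\mid Z)$, $$g(i,j) = \min\Big\{ \min_{z}\big[P(X=i,Y=j\mid Z=z)+P(X=1-i\mid Z=z)\big],\;$$ $$\min_{z,\tilde z:\, z\ne\tilde z}\big[P(X=i,Y=j\mid Z=z)+P(X=1-i,Y=0\mid Z=z)+P(X=i,Y=j\mid Z=\tilde z)+P(X=1-i,Y=1\mid Z=\tilde z)\big]\Big\},$$ where $z,\tilde z$ range over $\{1,\ldots,K\}$ (a minimum over an empty set is $+\infty$). Then for every distribution in $M$: (a) $P(Y(x_i)=j)\le g(i,j)$ for all $i,j\in\{0,1\}$. (b) $P(Y(x_0))$ and $P(Y(x_1))$ are variation independent: given the observed distributions $P(X,Y\mid Z)$, the set of pairs $(P(Y(x_0)=1),P(Y(x_1)=1))$ attained by distributions in $M$ with these observed distributions is the Cartesian product of the set of attained values of $P(Y(x_0)=1)$ and the set of attained values of $P(Y(x_1)=1)$. (c) Consequently, with $ACE(X\to Y)=P(Y(x_1)=1)-P(Y(x_0)=1)$, $$1-g(1,0)-g(0,1)\;\le\; ACE(X\to Y)\;\le\; g(0,0)+g(1,1)-1.$$ (d) These bounds are sharp: for any observed distributions $P(X,Y\mid Z)$ arising from some distribution in $M$, each of the bounds in (a) and each of the two bounds in (c) is attained by some distribution in $M$ having the same observed distributions $P(X,Y\mid Z)$.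
   Context: Treatment $X$ and response $Y$ take values in $\{0,1\}$; the instrument $Z$ takes values in $\{1,\ldots,K\}$, with $P(Z=z)>0$ for all $z$. The potential outcomes $Y(x_0),Y(x_1)$ are $\{0,1\}$-valued random variables, where $Y(x_i)$ denotes the value of $Y$ had $X$ been set to $i$ (the exclusion restriction $Y(x,z)=Y(x)$ is assumed, so potential outcomes for $Y$ do not depend on $z$). When they are assumed to exist, $X(z_1),\ldots,X(z_K)$ are $\{0,1\}$-valued potential outcomes, $X(z_k)$ being the value of $X$ had $Z$ been set to $k$. Consistency: $Y=Y(x_i)$ on the event $X=i$ (so $P(Y=y,X=i\mid Z=z)=P(Y(x_i)=y,X=i\mid Z=z)$), and, in models in which the $X(z_k)$ exist, $X=X(z_k)$ on the event $Z=k$. The four sets of assumptions are ($\perp\!\!\!\perp$ denotes independence): (i) potential outcomes $X(z_1),\ldots,X(z_K)$ exist and $Z\perp\!\!\!\perp (Y(x_0),Y(x_1),X(z_1),\ldots,X(z_K))$ jointly; (ii) $Z\perp\!\!\!\perp (Y(x_0),Y(x_1))$ jointly (no potential outcomes for $X$ are assumed); (iii) potential outcomes $X(z_1),\ldots,X(z_K)$ exist and, for each $k\in\{1,\ldots,K\}$ and $i\in\{0,1\}$, $Z\perp\!\!\!\perp (X(z_k),Y(x_i))$; (iv) there exists a random variable $U$ such that $U\perp\!\!\!\perp Z$ and, for each $i\in\{0,1\}$, $Y(x_i)\perp\!\!\!\perp (X,Z)\mid U$ (no potential outcomes for $X$ are assumed). $M_1,M_2,M_3,M_4$ denote the sets of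 joint distributions $P(Z,X,Y(x_0),Y(x_1))$ on $\{1,\ldots,K\}\times\{0,1\}^3$ that arise as the marginal of some joint distribution of all the variables posited in (i), (ii), (iii), (iv) respectively, satisfying the corresponding assumption and consistency. The observed distributions of $P\in M$ are the conditional distributions $P(X,Y\mid Z=z)$, $z\in\{1,\ldots,K\}$, with $Y$ determined by consistency. *)

theory Defs
  imports "HOL-Probability.Probability"
begin

text \<open>
  The values 0 and 1 of the treatment, the response and the potential outcomes are rendered as
  \<open>False\<close> and \<open>True\<close>, so that \<open>1 - i\<close> becomes \<open>\<not> i\<close>.
  An element of \<open>state\<close> is a tuple \<open>(Z, X, Y(x\<^sub>0), Y(x\<^sub>1))\<close>.
\<close>

type_synonym state = "nat \<times> bool \<times> bool \<times> bool"

definition Zvar :: "state \<Rightarrow> nat" where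
  "Zvar = (\<lambda>(z, x, y0, y1). z)"

definition Xvar :: "state \<Rightarrow> bool" where
  "Xvar = (\<lambda>(z, x, y0, y1). x)"

definition Ypot :: "bool \<Rightarrow> state \<Rightarrow> bool" where
  "Ypot i = (\<lambda>(z, x, y0, y1). if i then y1 else y0)"

text \<open>The observed response, determined by consistency.\<close>

definition Yvar :: "state \<Rightarrow> bool" where
  "Yvar \<omega> = Ypot (Xvar \<omega>) \<omega>"

text \<open>
  Independence of two random variables, stated through the library's \<open>indep_set\<close>. The library's
  \<open>indep_var\<close> forces both variables to have the same codomain type and hence cannot be used
  here.
\<close>

definition indep_rv ::
  "'a measure \<Rightarrow> 'b measure \<Rightarrow> ('a \<Rightarrow> 'b) \<Rightarrow> 'c measure \<Rightarrow> ('a \<Rightarrow> 'c) \<Rightarrow> bool" where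
  "indep_rv M S V T W \<longleftrightarrow>
     V \<in> measurable M S \<and> W \<in> measurable M T \<and>
     prob_space.indep_set M {V -` A \<inter> space M | A. A \<in> sets S} {W -` B \<inter> space M | B. B \<in> sets T}"

text \<open>
  Conditional independence of \<open>V\<close> and \<open>W\<close> given \<open>U\<close>, by means of
  conditional probabilities given the sigma-algebra generated by \<open>U\<close>; nothing is assumed about
  the measurable space \<open>N\<close> in which \<open>U\<close> takes its values.
\<close>

definition cond_indep_rv ::
  "'a measure \<Rightarrow> 'b measure \<Rightarrow> ('a \<Rightarrow> 'b) \<Rightarrow> 'c measure \<Rightarrow> ('a \<Rightarrow> 'c) \<Rightarrow> 'u measure \<Rightarrow> ('a \<Rightarrow> 'u) \<Rightarrow> bool" where
  "cond_indep_rv M S V T W N U \<longleftrightarrow>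
     V \<in> measurable M S \<and> W \<in> measurable M T \<and> U \<in> measurable M N \<and>
     (\<forall>A\<in>sets S. \<forall>B\<in>sets T. AE \<omega> in M.
        real_cond_exp M (vimage_algebra (space M) U N) (indicator (V -` A \<inter> W -` B \<inter> space M)) \<omega> =
        real_cond_exp M (vimage_algebra (space M) U N) (indicator (V -` A \<inter> space M)) \<omega> *
        real_cond_exp M (vimage_algebra (space M) U N) (indicator (W -` B \<inter> space M)) \<omega>)"

text \<open>\<open>Z\<close> takes values in \<open>{1..K}\<close>, each with positive probability.\<close>

definition instrument_ok :: "nat \<Rightarrow> state pmf \<Rightarrow> bool" where
  "instrument_ok K P \<longleftrightarrow> set_pmf (map_pmf Zvar P) = {1..K}"

text \<open>
  Joint distributions of \<open>(Z, X, Y(x\<^sub>0), Y(x\<^sub>1))\<close> together with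
  \<open>(X(z\<^sub>1), \<dots>, X(z\<^sub>K))\<close>, the latter encoded as a function on \<open>{1..K}\<close>,
  that satisfy \<open>X = X(z\<^sub>k)\<close> on the event \<open>Z = k\<close>.
\<close>

definition with_Xpot :: "nat \<Rightarrow> (state \<times> (nat \<Rightarrow> bool)) pmf \<Rightarrow> bool" where
  "with_Xpot K Q \<longleftrightarrow>
     (\<forall>(\<omega>, xz)\<in>set_pmf Q. xz \<in> {1..K} \<rightarrow>\<^sub>E UNIV \<and> Xvar \<omega> = xz (Zvar \<omega>))"

definition M1 :: "nat \<Rightarrow> state pmf set" where
  "M1 K = {P. instrument_ok K P \<and>
     (\<exists>Q. map_pmf fst Q = P \<and> with_Xpot K Q \<and>
        indep_rv (measure_pmf Q)
          (count_space UNIV) (\<lambda>(\<omega>, xz). Zvar \<omega>)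
          (count_space UNIV) (\<lambda>(\<omega>, xz). (Ypot False \<omega>, Ypot True \<omega>, xz)))}"

definition M2 :: "nat \<Rightarrow> state pmf set" where
  "M2 K = {P. instrument_ok K P \<and>
     indep_rv (measure_pmf P)
       (count_space UNIV) Zvar
       (count_space UNIV) (\<lambda>\<omega>. (Ypot False \<omega>, Ypot True \<omega>))}"

definition M3 :: "nat \<Rightarrow> state pmf set" where
  "M3 K = {P. instrument_ok K P \<and>
     (\<exists>Q. map_pmf fst Q = P \<and> with_Xpot K Q \<and>
        (\<forall>k\<in>{1..K}. \<forall>i. indep_rv (measure_pmf Q)
          (count_space UNIV) (\<lambda>(\<omega>, xz). Zvar \<omega>)
          (count_space UNIV) (\<lambda>(\<omega>, xz). (xz k, Ypot i \<omega>))))}"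

text \<open>
  \<open>U\<close> takes values in an arbitrary measurable space \<open>N\<close> over the type \<open>'u\<close>,
  and \<open>Q\<close> is the joint distribution of \<open>(U, (Z, X, Y(x\<^sub>0), Y(x\<^sub>1)))\<close>. The type is an
  explicit parameter because HOL cannot quantify existentially over types; over a type with too few
  elements (such as \<open>unit\<close>) the existence of \<open>U\<close> would be a genuine restriction.
\<close>

definition M4 :: "'u itself \<Rightarrow> nat \<Rightarrow> state pmf set" where
  "M4 _ K = {P. instrument_ok K P \<and>
     (\<exists>(N :: 'u measure) (Q :: ('u \<times> state) measure).
        prob_space Q \<and>
        sets Q = sets (N \<Otimes>\<^sub>M count_space UNIV) \<and>
        distr Q (count_space UNIV) snd = measure_pmf P \<and>
        indep_rv Q N fst (count_space UNIV) (\<lambda>(u, \<omega>). Zvar \<omega>) \<and>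
        (\<forall>i. cond_indep_rv Q
           (count_space UNIV) (\<lambda>(u, \<omega>). Ypot i \<omega>)
           (count_space UNIV) (\<lambda>(u, \<omega>). (Xvar \<omega>, Zvar \<omega>))
           N fst))}"

text \<open>\<open>observed P z x y\<close> is \<open>P(X = x, Y = y | Z = z)\<close>.\<close>

definition observed :: "state pmf \<Rightarrow> nat \<Rightarrow> bool \<Rightarrow> bool \<Rightarrow> real" where
  "observed P z x y = \<P>(\<omega> in measure_pmf P. Xvar \<omega> = x \<and> Yvar \<omega> = y \<bar> Zvar \<omega> = z)"

definition same_observed :: "nat \<Rightarrow> state pmf \<Rightarrow> state pmf \<Rightarrow> bool" where
  "same_observed K P P' \<longleftrightarrow> (\<forall>z\<in>{1..K}. \<forall>x y. observed P z x y = observed P' z x y)"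

definition prob_Ypot :: "state pmf \<Rightarrow> bool \<Rightarrow> bool \<Rightarrow> real" where
  "prob_Ypot P i j = \<P>(\<omega> in measure_pmf P. Ypot i \<omega> = j)"

definition ACE :: "state pmf \<Rightarrow> real" where
  "ACE P = prob_Ypot P True True - prob_Ypot P False True"

text \<open>
  The minimum of the two minima is taken as the minimum of the union, so that for \<open>K = 1\<close> the
  empty second family does not contribute (a minimum over the empty set being infinite).
\<close>

definition g :: "nat \<Rightarrow> (nat \<Rightarrow> bool \<Rightarrow> bool \<Rightarrow> real) \<Rightarrow> bool \<Rightarrow> bool \<Rightarrow> real" where
  "g K p i j = Min
     ({p z i j + (\<Sum>y\<in>UNIV. p z (\<not> i) y) | z. z \<in> {1..K}} \<union>
      {p z i j + p z (\<not> i) False + p z' i j + p z' (\<not> i) True | z z'.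
         z \<in> {1..K} \<and> z' \<in> {1..K} \<and> z \<noteq> z'})"

end

theory Submission
  imports Defs
begin

text \<open>
  Write \<open>p\<^sub>z(x, y)\<close> for \<open>P(X = x, Y = y | Z = z)\<close>. The model \<open>M1\<close> is contained in \<open>M2\<close> and
  \<open>M3\<close>, and \<open>M2\<close> is contained in \<open>M4\<close> (\<open>M2_subset_M4\<close>: take \<open>U = (Y(x\<^sub>0), Y(x\<^sub>1))\<close>).
  It therefore suffices to prove the bounds \<open>P(Y(x\<^sub>i) = j) \<le> g(i, j)\<close> in \<open>M2\<close>, \<open>M3\<close> and \<open>M4\<close>,
  and to realise in \<open>M1\<close> every pair of response margins satisfying them. All four models then
  attain the same set of pairs, the rectangle
  \<open>[1 - g(0,0), g(0,1)] \<times> [1 - g(1,0), g(1,1)]\<close>, and the remaining claims are read off from it.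

  The bounds. In \<open>M2\<close>, \<open>P(Y(x\<^sub>i) = j, Y(x\<^sub>1\<^sub>-\<^sub>i) = b)\<close> is at most
  \<open>p\<^sub>z(i, j) + p\<^sub>z(1 - i, b)\<close> for every \<open>z\<close>, and one adds the cases \<open>b = 0\<close> and \<open>b = 1\<close>
  with different instrument values (\<open>M2_bound\<close>). In \<open>M3\<close>, \<open>p\<^sub>z(x, y)\<close> is the probability of
  \<open>X(z) = x, Y(x) = y\<close>, and a union bound gives the claim (\<open>M3_bound\<close>). In \<open>M4\<close>, the same
  inequality holds pointwise for the conditional probabilities given \<open>U\<close> and is integrated
  (\<open>M4_bound\<close>).

  The realisation (\<open>M1_realises_marginals\<close>). It requires a joint law \<open>r\<close> of
  \<open>(Y(x\<^sub>0), Y(x\<^sub>1))\<close> with the prescribed margins and, for each \<open>z\<close>, a law of \<open>X\<close> given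
  \<open>(Y(x\<^sub>0), Y(x\<^sub>1))\<close> reproducing \<open>p\<^sub>z\<close>. The latter is a two-by-two table with entries
  between 0 and \<open>r\<close> and with prescribed margins; it exists if and only if
  \<open>r(a, b) \<le> p\<^sub>z(0, a) + p\<^sub>z(1, b)\<close> and the margins of \<open>r\<close> satisfy the one-instrument bounds.
  So \<open>r\<close> is itself a two-by-two table with prescribed margins and bounded entries, and the
  solvability criterion \<open>transportation_2x2\<close>, used a second time, turns out to be implied by the
  inequalities that define \<open>g\<close>.
\<close>

section \<open>Two-by-two tables with bounded entries\<close>

text \<open>
  A table with row sums \<open>R\<close>, column sums \<open>C\<close> and entries between 0 and \<open>U\<close>
  exists under the evident necessary conditions. Once the margins agree in total, such a table is
  determined by its entry at \<open>(True, True)\<close>; the eight inequalities on the entries become four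
  lower and four upper bounds on this number, and each lower bound is below each upper bound.
\<close>

lemma transportation_2x2:
  fixes U :: "bool \<Rightarrow> bool \<Rightarrow> real" and R C :: "bool \<Rightarrow> real"
  assumes total: "R False + R True = C False + C True"
    and R: "\<And>a. 0 \<le> R a" "\<And>a. R a \<le> U a False + U a True"
    and C: "\<And>b. 0 \<le> C b" "\<And>b. C b \<le> U False b + U True b"
    and U: "\<And>a b. 0 \<le> U a b"
    and cross: "\<And>a b. C b - R a \<le> U (\<not> a) b"
  obtains w :: "bool \<Rightarrow> bool \<Rightarrow> real"
  where "\<And>a b. 0 \<le> w a b" "\<And>a b. w a b \<le> U a b"
    and "\<And>a. w a False + w a True = R a" "\<And>b. w False b + w True b = C b"
proof -
  define s where "s = max (max 0 (R True - U True False)) (max (C True - U False True) (C True - R False))"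
  define w where "w = (\<lambda>a b. if a then if b then s else R True - s
                             else if b then C True - s else R False - C True + s)"
  note facts = total R[of False] R[of True] C[of False] C[of True]
    U[of False False] U[of False True] U[of True False] U[of True True]
    cross[of False False] cross[of False True] cross[of True False] cross[of True True]
  have lower: "0 \<le> s" "R True - U True False \<le> s" "C True - U False True \<le> s" "C True - R False \<le> s"
    unfolding s_def by auto
  have upper: "s \<le> U True True" "s \<le> R True" "s \<le> C True" "s \<le> U False False - R False + C True"
    unfolding s_def using facts by auto
  show thesis
  proof (rule that[of w])
    fix a b
    show "0 \<le> w a b" "w a b \<le> U a b" using lower upper by (auto simp: w_def)
    show "w a False + w a True = R a" by (auto simp: w_def)
    show "w False b + w True b = C b" using total by (auto simp: w_def)
  qed
qed

section \<open>The bound function\<close>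

lemma le_g_iff:
  assumes "K \<ge> 1"
  shows "q \<le> g K p i j \<longleftrightarrow>
    (\<forall>z\<in>{1..K}. q \<le> p z i j + (p z (\<not> i) False + p z (\<not> i) True)) \<and>
    (\<forall>z\<in>{1..K}. \<forall>z'\<in>{1..K}. z \<noteq> z' \<longrightarrow>
       q \<le> p z i j + p z (\<not> i) False + p z' i j + p z' (\<not> i) True)"
proof -
  let ?A = "{p z i j + (\<Sum>y\<in>UNIV. p z (\<not> i) y) | z. z \<in> {1..K}}"
  let ?B = "{p z i j + p z (\<not> i) False + p z' i j + p z' (\<not> i) True | z z'.
         z \<in> {1..K} \<and> z' \<in> {1..K} \<and> z \<noteq> z'}"
  have "finite ?A" by simp
  moreover have "finite ?B"
    by (rule finite_subset[of _ "(\<lambda>(z, z'). p z i j + p z (\<not> i) False + p z' i j + p z' (\<not> i) True) `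
      ({1..K} \<times> {1..K})"]) auto
  moreover have "?A \<noteq> {}" using assms by auto
  ultimately have "q \<le> g K p i j \<longleftrightarrow> (\<forall>x\<in>?A \<union> ?B. q \<le> x)"
    unfolding g_def by (subst Min_ge_iff) auto
  also have "\<dots> \<longleftrightarrow> (\<forall>z\<in>{1..K}. q \<le> p z i j + (p z (\<not> i) False + p z (\<not> i) True)) \<and>
    (\<forall>z\<in>{1..K}. \<forall>z'\<in>{1..K}. z \<noteq> z' \<longrightarrow>
       q \<le> p z i j + p z (\<not> i) False + p z' i j + p z' (\<not> i) True)"
    unfolding ball_Un by (fastforce simp: UNIV_bool)
  finally show ?thesis .
qed

lemma g_cong:
  assumes "K \<ge> 1" and "\<And>z x y. z \<in> {1..K} \<Longrightarrow> p z x y = p' z x y"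
  shows "g K p i j = g K p' i j"
proof -
  have "q \<le> g K p i j \<longleftrightarrow> q \<le> g K p' i j" for q
    unfolding le_g_iff[OF assms(1)] using assms(2) by simp
  then show ?thesis by (meson order_antisym order_refl)
qed

section \<open>Joint laws compatible with given response margins\<close>

text \<open>
  A joint law \<open>r\<close> of \<open>(Y(x\<^sub>0), Y(x\<^sub>1))\<close> with margins \<open>q\<close> can produce the observed
  law \<open>p z\<close> only if \<open>r a b \<le> p z False a + p z True b\<close> for every \<open>z\<close>, since a unit with
  response type \<open>(a, b)\<close> is observed either with \<open>X = 0, Y = a\<close> or with \<open>X = 1, Y = b\<close>.
  With \<open>m a b\<close> the minimum over \<open>z\<close> of the right-hand side, the requirement that each row sum and
  column sum of the table be at most the corresponding sum of \<open>m\<close> is the second family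
  in the definition of \<open>g\<close>, evaluated at the two instrument values at which the two minima are
  attained; if these coincide, it follows from the first family.
\<close>

lemma response_law_exists:
  fixes p :: "nat \<Rightarrow> bool \<Rightarrow> bool \<Rightarrow> real" and q :: "bool \<Rightarrow> bool \<Rightarrow> real"
  assumes K: "K \<ge> 1"
    and p: "\<And>z x y. 0 \<le> p z x y"
      "\<And>z. z \<in> {1..K} \<Longrightarrow> p z False False + p z False True + p z True False + p z True True = 1"
    and q: "\<And>i. q i False + q i True = 1" "\<And>i j. q i j \<le> g K p i j"
  obtains r :: "bool \<Rightarrow> bool \<Rightarrow> real"
  where "\<And>a b. 0 \<le> r a b"
    and "\<And>a. r a False + r a True = q False a" "\<And>b. r False b + r True b = q True b"
    and "\<And>z a b. z \<in> {1..K} \<Longrightarrow> r a b \<le> p z False a + p z True b"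
proof -
  define m where "m a b = Min ((\<lambda>z. p z False a + p z True b) ` {1..K})" for a b
  have m_le: "m a b \<le> p z False a + p z True b" if "z \<in> {1..K}" for z a b
    unfolding m_def using that by (intro Min_le) auto
  have m_attained: "\<exists>z\<in>{1..K}. m a b = p z False a + p z True b" for a b
  proof -
    have "m a b \<in> (\<lambda>z. p z False a + p z True b) ` {1..K}"
      unfolding m_def using K by (intro Min_in) auto
    then show ?thesis by auto
  qed
  have single: "q i j \<le> p z i j + (p z (\<not> i) False + p z (\<not> i) True)" if "z \<in> {1..K}" for z i j
    using q(2)[of i j] that unfolding le_g_iff[OF K] by blast
  have double: "q i j \<le> p z i j + p z (\<not> i) False + p z' i j + p z' (\<not> i) True"
    if "z \<in> {1..K}" "z' \<in> {1..K}" for z z' i j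
  proof (cases "z = z'")
    case True
    then show ?thesis using single[OF that(1), of i j] p(1)[of z i j] by simp
  next
    case False
    then show ?thesis using q(2)[of i j] that unfolding le_g_iff[OF K] by blast
  qed
  have q_ge: "p z i j \<le> q i j" if z: "z \<in> {1..K}" for z i j
    using single[OF z, of i "\<not> j"] q(1)[of i] p(2)[OF z] by (cases i; cases j) auto
  have one: "1 \<in> {1..K}" using K by simp
  have q_nonneg: "0 \<le> q i j" for i j
    using q_ge[OF one] p(1) order_trans by blast
  have rows: "q False a \<le> m a False + m a True" for a
  proof -
    obtain z z' where "z \<in> {1..K}" "z' \<in> {1..K}"
      "m a False = p z False a + p z True False" "m a True = p z' False a + p z' True True"
      using m_attained by metis
    then show ?thesis using double[of z z' False a] by simp
  qed
  have columns: "q True b \<le> m False b + m True b" for b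
  proof -
    obtain z z' where "z \<in> {1..K}" "z' \<in> {1..K}"
      "m False b = p z False False + p z True b" "m True b = p z' False True + p z' True b"
      using m_attained by metis
    then show ?thesis using double[of z z' True b] by simp
  qed
  have m_nonneg: "0 \<le> m a b" for a b using m_attained[of a b] p(1) by auto
  have cross: "q True b - q False a \<le> m (\<not> a) b" for a b
  proof -
    obtain z where z: "z \<in> {1..K}" "m (\<not> a) b = p z False (\<not> a) + p z True b"
      using m_attained by metis
    then show ?thesis
      using single[OF z(1), of True b] q_ge[OF z(1), of False a] by (cases a) auto
  qed
  have "q False False + q False True = q True False + q True True" using q(1) by simp
  then obtain r where r: "\<And>a b. 0 \<le> r a b" "\<And>a b. r a b \<le> m a b"
    "\<And>a. r a False + r a True = q False a" "\<And>b. r False b + r True b = q True b"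
    using transportation_2x2[of "q False" "q True" m] q_nonneg rows columns m_nonneg cross
    by metis
  show thesis
  proof (rule that[of r])
    show "r a b \<le> p z False a + p z True b" if "z \<in> {1..K}" for z a b
      using m_le[OF that, of a b] r(2)[of a b] by linarith
  qed (use r in auto)
qed

text \<open>
  For one value of the instrument: \<open>w a b\<close> is the probability of \<open>X = 1\<close>, \<open>Y(x\<^sub>0) = a\<close>,
  \<open>Y(x\<^sub>1) = b\<close>, and the conclusion says that the resulting observed law is \<open>p\<close>.
\<close>

lemma treatment_law_exists:
  fixes p r :: "bool \<Rightarrow> bool \<Rightarrow> real"
  assumes p: "\<And>x y. 0 \<le> p x y" "p False False + p False True + p True False + p True True = 1"
    and r: "\<And>a b. 0 \<le> r a b" "r False False + r False True + r True False + r True True = 1"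
    and rp: "\<And>a b. r a b \<le> p False a + p True b"
    and r0: "\<And>a. p False a \<le> r a False + r a True"
    and r1: "\<And>b. p True b \<le> r False b + r True b"
  obtains w :: "bool \<Rightarrow> bool \<Rightarrow> real"
  where "\<And>a b. 0 \<le> w a b" "\<And>a b. w a b \<le> r a b"
    and "\<And>a. (r a False - w a False) + (r a True - w a True) = p False a"
    and "\<And>b. w False b + w True b = p True b"
proof (rule transportation_2x2[of "\<lambda>a. r a False + r a True - p False a" "p True" r])
  show "p True b - (r a False + r a True - p False a) \<le> r (\<not> a) b" for a b
    using rp[of "\<not> a" "\<not> b"] p(2) r(2) by (cases a; cases b) auto
next
  fix w assume w: "\<And>a b. 0 \<le> w a b" "\<And>a b. w a b \<le> r a b"
    "\<And>a. w a False + w a True = r a False + r a True - p False a"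
    "\<And>b. w False b + w True b = p True b"
  show thesis
  proof (rule that[of w])
    show "(r a False - w a False) + (r a True - w a True) = p False a" for a
      using w(3)[of a] by simp
  qed (use w in auto)
qed (use p r r0 r1 in auto)

section \<open>Observed distributions and response margins\<close>

lemma Xvar_simp [simp]: "Xvar (z, x, a, b) = x" by (simp add: Xvar_def)

lemma Zvar_simp [simp]: "Zvar (z, x, a, b) = z" by (simp add: Zvar_def)

lemma Ypot_simp [simp]: "Ypot i (z, x, a, b) = (if i then b else a)" by (simp add: Ypot_def)

lemma Zvar_prob_pos:
  assumes "instrument_ok K P" "z \<in> {1..K}"
  shows "0 < measure_pmf.prob P {\<omega>. Zvar \<omega> = z}"
proof -
  have "z \<in> set_pmf (map_pmf Zvar P)" using assms unfolding instrument_ok_def by simp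
  then have "0 < pmf (map_pmf Zvar P) z" by (simp add: pmf_positive)
  then show ?thesis by (simp add: pmf_map vimage_def)
qed

lemma observed_eq:
  "observed P z x y = measure_pmf.prob P {\<omega>. Zvar \<omega> = z \<and> Xvar \<omega> = x \<and> Ypot x \<omega> = y} /
    measure_pmf.prob P {\<omega>. Zvar \<omega> = z}"
proof -
  have "{\<omega>. (Xvar \<omega> = x \<and> Yvar \<omega> = y) \<and> Zvar \<omega> = z} =
    {\<omega>. Zvar \<omega> = z \<and> Xvar \<omega> = x \<and> Ypot x \<omega> = y}"
    by (auto simp: Yvar_def)
  then show ?thesis unfolding observed_def cond_prob_def by simp
qed

lemma prob_Ypot_eq: "prob_Ypot P i j = measure_pmf.prob P {\<omega>. Ypot i \<omega> = j}"
  by (simp add: prob_Ypot_def)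

lemma observed_nonneg: "0 \<le> observed P z x y"
  by (simp add: observed_eq)

lemma observed_sum:
  assumes "instrument_ok K P" "z \<in> {1..K}"
  shows "observed P z False False + observed P z False True
       + observed P z True False + observed P z True True = 1"
proof -
  let ?c = "\<lambda>x y. measure_pmf.prob P {\<omega>. Zvar \<omega> = z \<and> Xvar \<omega> = x \<and> Ypot x \<omega> = y}"
  have split: "measure_pmf.prob P {\<omega>. S \<omega>} =
    measure_pmf.prob P {\<omega>. S \<omega> \<and> \<not> T \<omega>} + measure_pmf.prob P {\<omega>. S \<omega> \<and> T \<omega>}" for S T
    by (subst measure_pmf.finite_measure_Union[symmetric]) (auto intro!: arg_cong[where f="measure _"])
  have "measure_pmf.prob P {\<omega>. Zvar \<omega> = z} =
    ?c False False + ?c False True + ?c True False + ?c True True"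
    by (subst split[of _ Xvar], subst split[of "\<lambda>\<omega>. Zvar \<omega> = z \<and> \<not> Xvar \<omega>" "Ypot False"],
        subst split[of "\<lambda>\<omega>. Zvar \<omega> = z \<and> Xvar \<omega>" "Ypot True"]) simp
  then have "?c False False + ?c False True + ?c True False + ?c True True =
    measure_pmf.prob P {\<omega>. Zvar \<omega> = z}" ..
  then show ?thesis
    using Zvar_prob_pos[OF assms] by (simp add: observed_eq flip: add_divide_distrib)
qed

lemma prob_Ypot_sum: "prob_Ypot P i False + prob_Ypot P i True = 1"
proof -
  have "measure_pmf.prob P {\<omega>. Ypot i \<omega> = True} = 1 - measure_pmf.prob P {\<omega>. Ypot i \<omega> = False}"
    by (subst measure_pmf.prob_compl[symmetric]) (auto intro!: arg_cong[where f="measure _"])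
  then show ?thesis by (simp add: prob_Ypot_eq)
qed

lemma same_observed_g:
  assumes "K \<ge> 1" "same_observed K P' P"
  shows "g K (observed P') i j = g K (observed P) i j"
  by (rule g_cong) (use assms in \<open>auto simp: same_observed_def\<close>)

section \<open>The model with jointly independent potential outcomes is the smallest of the first three\<close>

lemma indep_rv_pmf_iff:
  "indep_rv (measure_pmf Q) (count_space UNIV) V (count_space UNIV) W \<longleftrightarrow>
    (\<forall>A B. measure_pmf.prob Q (V -` A \<inter> W -` B) =
       measure_pmf.prob Q (V -` A) * measure_pmf.prob Q (W -` B))"
  unfolding indep_rv_def
  by (auto intro!: prob_space.indep_setI[OF prob_space_measure_pmf] dest!: prob_space.indep_setD[OF prob_space_measure_pmf])

lemma M1_subset_M2: "M1 K \<subseteq> M2 K"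
proof
  fix P assume "P \<in> M1 K"
  then obtain Q where P: "instrument_ok K P" and Q: "map_pmf fst Q = P" "with_Xpot K Q"
    and ind: "indep_rv (measure_pmf Q)
          (count_space UNIV) (\<lambda>(\<omega>, xz). Zvar \<omega>)
          (count_space UNIV) (\<lambda>(\<omega>, xz). (Ypot False \<omega>, Ypot True \<omega>, xz))"
    unfolding M1_def mem_Collect_eq by blast
  have "measure_pmf.prob P (Zvar -` A \<inter> (\<lambda>\<omega>. (Ypot False \<omega>, Ypot True \<omega>)) -` B) =
    measure_pmf.prob P (Zvar -` A) * measure_pmf.prob P ((\<lambda>\<omega>. (Ypot False \<omega>, Ypot True \<omega>)) -` B)" for A B
    using ind[unfolded indep_rv_pmf_iff, rule_format, of A "{(a, b, xz). (a, b) \<in> B}"]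
    unfolding Q(1)[symmetric] measure_map_pmf by (simp add: vimage_def case_prod_unfold Int_def)
  then show "P \<in> M2 K" using P unfolding M2_def indep_rv_pmf_iff by simp
qed

lemma M1_subset_M3: "M1 K \<subseteq> M3 K"
proof
  fix P assume "P \<in> M1 K"
  then obtain Q where P: "instrument_ok K P" and Q: "map_pmf fst Q = P" "with_Xpot K Q"
    and ind: "indep_rv (measure_pmf Q)
          (count_space UNIV) (\<lambda>(\<omega>, xz). Zvar \<omega>)
          (count_space UNIV) (\<lambda>(\<omega>, xz). (Ypot False \<omega>, Ypot True \<omega>, xz))"
    unfolding M1_def mem_Collect_eq by blast
  have "indep_rv (measure_pmf Q) (count_space UNIV) (\<lambda>(\<omega>, xz). Zvar \<omega>)
      (count_space UNIV) (\<lambda>(\<omega>, xz). (xz k, Ypot i \<omega>))" for k i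
    unfolding indep_rv_pmf_iff
  proof (intro allI)
    fix A B
    show "measure_pmf.prob Q ((\<lambda>(\<omega>, xz). Zvar \<omega>) -` A \<inter> (\<lambda>(\<omega>, xz). (xz k, Ypot i \<omega>)) -` B) =
      measure_pmf.prob Q ((\<lambda>(\<omega>, xz). Zvar \<omega>) -` A) *
      measure_pmf.prob Q ((\<lambda>(\<omega>, xz). (xz k, Ypot i \<omega>)) -` B)"
      using ind[unfolded indep_rv_pmf_iff, rule_format,
          of A "{(a, b, xz). (xz k, if i then b else a) \<in> B}"]
      by (cases i) (simp_all add: vimage_def case_prod_unfold Int_def)
  qed
  then show "P \<in> M3 K" using P Q unfolding M3_def by blast
qed

section \<open>Bounds under independence of the instrument and the potential outcomes\<close>

text \<open>
  \<open>joint b\<close> is the probability of \<open>Y(x\<^sub>i) = j, Y(x\<^sub>1\<^sub>-\<^sub>i) = b\<close>. It can be bounded using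
  any value of the instrument, and the second family in \<open>g\<close> arises by using different values for
  \<open>b = 0\<close> and \<open>b = 1\<close>.
\<close>

lemma M2_bound:
  assumes K: "K \<ge> 1" and "P \<in> M2 K"
  shows "prob_Ypot P i j \<le> g K (observed P) i j"
proof -
  let ?P = "measure_pmf.prob P"
  have P: "instrument_ok K P"
    and ind: "\<And>A B. ?P (Zvar -` A \<inter> (\<lambda>\<omega>. (Ypot False \<omega>, Ypot True \<omega>)) -` B) =
      ?P (Zvar -` A) * ?P ((\<lambda>\<omega>. (Ypot False \<omega>, Ypot True \<omega>)) -` B)"
    using assms(2) unfolding M2_def indep_rv_pmf_iff by auto
  define c where "c z x y = ?P {\<omega>. Zvar \<omega> = z \<and> Xvar \<omega> = x \<and> Ypot x \<omega> = y}" for z x y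
  define joint where "joint b = ?P {\<omega>. Ypot i \<omega> = j \<and> Ypot (\<not> i) \<omega> = b}" for b
  have le: "joint b \<le> observed P z i j + observed P z (\<not> i) b" if z: "z \<in> {1..K}" for z b
  proof -
    have "joint b * ?P {\<omega>. Zvar \<omega> = z} = ?P {\<omega>. Zvar \<omega> = z \<and> Ypot i \<omega> = j \<and> Ypot (\<not> i) \<omega> = b}"
      using ind[of "{z}" "if i then {(b, j)} else {(j, b)}"]
      by (cases i) (simp_all add: joint_def vimage_def Int_def conj_ac mult.commute)
    also have "\<dots> \<le> ?P ({\<omega>. Zvar \<omega> = z \<and> Xvar \<omega> = i \<and> Ypot i \<omega> = j} \<union>
      {\<omega>. Zvar \<omega> = z \<and> Xvar \<omega> = (\<not> i) \<and> Ypot (\<not> i) \<omega> = b})"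
      by (rule measure_pmf.finite_measure_mono) auto
    also have "\<dots> \<le> c z i j + c z (\<not> i) b"
      unfolding c_def by (rule measure_Un_le) auto
    finally show ?thesis
      using Zvar_prob_pos[OF P z] by (simp add: observed_eq c_def field_simps)
  qed
  have split: "prob_Ypot P i j = joint False + joint True"
    unfolding prob_Ypot_eq joint_def
    by (subst measure_pmf.finite_measure_Union[symmetric]) (auto intro!: arg_cong[where f="?P"])
  have single: "prob_Ypot P i j \<le> observed P z i j + (observed P z (\<not> i) False + observed P z (\<not> i) True)"
    if z: "z \<in> {1..K}" for z
  proof -
    have "prob_Ypot P i j * ?P {\<omega>. Zvar \<omega> = z} = ?P {\<omega>. Zvar \<omega> = z \<and> Ypot i \<omega> = j}"
      using ind[of "{z}" "{(a, b). (if i then b else a) = j}"]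
      by (cases i) (simp_all add: prob_Ypot_eq vimage_def Int_def conj_ac mult.commute)
    also have "\<dots> \<le> ?P ({\<omega>. Zvar \<omega> = z \<and> Xvar \<omega> = i \<and> Ypot i \<omega> = j} \<union>
      ({\<omega>. Zvar \<omega> = z \<and> Xvar \<omega> = (\<not> i) \<and> Ypot (\<not> i) \<omega> = False} \<union>
       {\<omega>. Zvar \<omega> = z \<and> Xvar \<omega> = (\<not> i) \<and> Ypot (\<not> i) \<omega> = True}))"
      by (rule measure_pmf.finite_measure_mono) auto
    also have "\<dots> \<le> c z i j + (c z (\<not> i) False + c z (\<not> i) True)"
      unfolding c_def by (intro order_trans[OF measure_Un_le]
          add_left_mono measure_Un_le) auto
    finally show ?thesis
      using Zvar_prob_pos[OF P z] by (simp add: observed_eq c_def field_simps)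
  qed
  show ?thesis
    unfolding le_g_iff[OF K]
  proof (intro conjI ballI impI)
    fix z z' assume "z \<in> {1..K}" "z' \<in> {1..K}"
    then show "prob_Ypot P i j \<le> observed P z i j + observed P z (\<not> i) False +
        observed P z' i j + observed P z' (\<not> i) True"
      using le[of z False] le[of z' True] split by simp
  qed (rule single)
qed

text \<open>
  Here the joint law of \<open>(Y(x\<^sub>0), Y(x\<^sub>1))\<close> may depend on \<open>Z\<close>. However, the event
  \<open>E z x y\<close>, that \<open>X(z) = x\<close> and \<open>Y(x) = y\<close>, has probability \<open>P(X = x, Y = y | Z = z)\<close>,
  and both bounds are union bounds: if \<open>Y(x\<^sub>i) = j\<close>, then \<open>X(z) = i\<close>, or \<open>X(z') = i\<close>, or
  both treatments equal \<open>1 - i\<close> and \<open>Y(x\<^sub>1\<^sub>-\<^sub>i)\<close> is 0 or 1.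
\<close>

lemma M3_bound:
  assumes K: "K \<ge> 1" and "P \<in> M3 K"
  shows "prob_Ypot P i j \<le> g K (observed P) i j"
proof -
  obtain Q where P: "instrument_ok K P" and Q: "map_pmf fst Q = P" "with_Xpot K Q"
    and ind: "\<forall>k\<in>{1..K}. \<forall>i. indep_rv (measure_pmf Q)
          (count_space UNIV) (\<lambda>(\<omega>, xz). Zvar \<omega>)
          (count_space UNIV) (\<lambda>(\<omega>, xz). (xz k, Ypot i \<omega>))"
    using assms(2) unfolding M3_def mem_Collect_eq by blast
  let ?Q = "measure_pmf.prob Q"
  define E where "E z x y = {(\<omega> :: state, xz :: nat \<Rightarrow> bool). xz z = x \<and> Ypot x \<omega> = y}" for z x y
  have E: "?Q (E z x y) = observed P z x y" if z: "z \<in> {1..K}" for z x y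
  proof -
    have P_Q: "measure_pmf.prob P S = ?Q {(\<omega>, xz). \<omega> \<in> S}" for S
      unfolding Q(1)[symmetric] measure_map_pmf by (simp add: vimage_def case_prod_unfold)
    have "measure_pmf.prob P {\<omega>. Zvar \<omega> = z \<and> Xvar \<omega> = x \<and> Ypot x \<omega> = y} =
      ?Q ((\<lambda>(\<omega>, xz). Zvar \<omega>) -` {z} \<inter> (\<lambda>(\<omega>, xz). (xz z, Ypot x \<omega>)) -` {(x, y)})"
      unfolding P_Q using Q(2) unfolding with_Xpot_def
      by (intro measure_pmf.finite_measure_eq_AE) (auto intro!: AE_pmfI)
    also have "\<dots> = ?Q ((\<lambda>(\<omega>, xz). Zvar \<omega>) -` {z}) * ?Q ((\<lambda>(\<omega>, xz). (xz z, Ypot x \<omega>)) -` {(x, y)})"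
      using ind z unfolding indep_rv_pmf_iff by blast
    also have "?Q ((\<lambda>(\<omega>, xz). Zvar \<omega>) -` {z}) = measure_pmf.prob P {\<omega>. Zvar \<omega> = z}"
      unfolding P_Q by (simp add: vimage_def case_prod_unfold)
    also have "(\<lambda>(\<omega>, xz). (xz z, Ypot x \<omega>)) -` {(x, y)} = E z x y"
      by (auto simp: E_def)
    finally show ?thesis
      using Zvar_prob_pos[OF P z] by (simp add: observed_eq)
  qed
  have Y: "prob_Ypot P i j = ?Q {(\<omega>, xz). Ypot i \<omega> = j}"
    unfolding prob_Ypot_eq Q(1)[symmetric] measure_map_pmf by (simp add: vimage_def case_prod_unfold)
  show ?thesis
    unfolding le_g_iff[OF K] Y
  proof (intro conjI ballI impI)
    fix z assume z: "z \<in> {1..K}"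
    have "?Q {(\<omega>, xz). Ypot i \<omega> = j} \<le> ?Q (E z i j \<union> (E z (\<not> i) False \<union> E z (\<not> i) True))"
      by (rule measure_pmf.finite_measure_mono) (auto simp: E_def)
    also have "\<dots> \<le> ?Q (E z i j) + (?Q (E z (\<not> i) False) + ?Q (E z (\<not> i) True))"
      by (intro order_trans[OF measure_Un_le]
          add_left_mono measure_Un_le) auto
    finally show "?Q {(\<omega>, xz). Ypot i \<omega> = j} \<le>
      observed P z i j + (observed P z (\<not> i) False + observed P z (\<not> i) True)"
      by (simp only: E[OF z])
  next
    fix z z' assume z: "z \<in> {1..K}" "z' \<in> {1..K}"
    have "?Q {(\<omega>, xz). Ypot i \<omega> = j} \<le>
      ?Q (((E z i j \<union> E z (\<not> i) False) \<union> E z' i j) \<union> E z' (\<not> i) True)"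
      by (rule measure_pmf.finite_measure_mono) (auto simp: E_def)
    also have "\<dots> \<le> ?Q (E z i j) + ?Q (E z (\<not> i) False) + ?Q (E z' i j) + ?Q (E z' (\<not> i) True)"
      by (intro order_trans[OF measure_Un_le]
          add_right_mono measure_Un_le) auto
    finally show "?Q {(\<omega>, xz). Ypot i \<omega> = j} \<le>
      observed P z i j + observed P z (\<not> i) False + observed P z' i j + observed P z' (\<not> i) True"
      by (simp only: E[OF z(1)] E[OF z(2)])
  qed
qed

section \<open>Construction of a jointly independent model\<close>

text \<open>
  \<open>Z\<close> is drawn from \<open>\<zeta>\<close> and, independently, the response type
  \<open>v = (Y(x\<^sub>0), Y(x\<^sub>1))\<close> from \<open>\<pi>\<close>; given \<open>v\<close>, the potential treatments \<open>X(z\<^sub>k)\<close> are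
  independent with success probabilities \<open>c k v\<close>. The default value \<open>undefined\<close> makes the
  function \<open>k \<mapsto> X(z\<^sub>k)\<close> extensional on \<open>{1..K}\<close>.
\<close>

lemma M1_from_response_law:
  fixes \<zeta> :: "nat pmf" and \<pi> :: "(bool \<times> bool) pmf" and c :: "nat \<Rightarrow> bool \<times> bool \<Rightarrow> real"
  assumes \<zeta>: "set_pmf \<zeta> = {1..K}"
  obtains P where "P \<in> M1 K" "map_pmf Zvar P = \<zeta>"
    and "map_pmf (\<lambda>\<omega>. (Ypot False \<omega>, Ypot True \<omega>)) P = \<pi>"
    and "\<And>z x y. z \<in> {1..K} \<Longrightarrow>
      measure_pmf.prob P {\<omega>. Zvar \<omega> = z \<and> Xvar \<omega> = x \<and> Ypot x \<omega> = y} =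
      pmf \<zeta> z * (\<Sum>v | (if x then snd v else fst v) = y. pmf \<pi> v * pmf (bernoulli_pmf (c z v)) x)"
proof -
  define \<rho> where "\<rho> = bind_pmf \<pi> (\<lambda>v. map_pmf (Pair v)
    (Pi_pmf {1..K} undefined (\<lambda>k. bernoulli_pmf (c k v))))"
  define Q where "Q = map_pmf (\<lambda>(z, v, xz). ((z, xz z, v), xz)) (pair_pmf \<zeta> \<rho>)"
  define P where "P = map_pmf fst Q"
  have map_fst_\<rho>: "map_pmf fst \<rho> = \<pi>"
    by (simp add: \<rho>_def map_bind_pmf map_pmf_comp bind_return_pmf')
  have map_Zvar: "map_pmf Zvar P = \<zeta>"
    by (simp add: P_def Q_def map_pmf_comp case_prod_unfold Zvar_def map_fst_pair_pmf)
  have map_Y: "map_pmf (\<lambda>\<omega>. (Ypot False \<omega>, Ypot True \<omega>)) P = \<pi>"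
  proof -
    have "map_pmf (\<lambda>\<omega>. (Ypot False \<omega>, Ypot True \<omega>)) P = map_pmf fst (map_pmf snd (pair_pmf \<zeta> \<rho>))"
      by (simp add: P_def Q_def map_pmf_comp case_prod_unfold Ypot_def del: map_snd_pair_pmf)
    then show ?thesis by (simp add: map_snd_pair_pmf map_fst_\<rho>)
  qed
  have product: "measure_pmf.prob (pair_pmf \<zeta> \<rho>) {(z, r). z \<in> A \<and> r \<in> B} =
    measure_pmf.prob \<zeta> A * measure_pmf.prob \<rho> B" for A B
  proof -
    have "measure_pmf.prob (pair_pmf \<zeta> \<rho>) {(z, r). z \<in> A \<and> r \<in> B} =
      measure_pmf.prob (pair_pmf \<zeta> \<rho>) ((A \<inter> set_pmf \<zeta>) \<times> (B \<inter> set_pmf \<rho>))"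
      by (rule measure_pmf.finite_measure_eq_AE) (auto intro!: AE_pmfI)
    also have "\<dots> = measure_pmf.prob \<zeta> (A \<inter> set_pmf \<zeta>) * measure_pmf.prob \<rho> (B \<inter> set_pmf \<rho>)"
      by (rule measure_pmf_prob_product) (auto intro: countable_Int2)
    finally show ?thesis by (simp add: measure_Int_set_pmf)
  qed
  have "with_Xpot K Q"
  proof -
    have "xz \<in> {1..K} \<rightarrow>\<^sub>E UNIV" if "(v, xz) \<in> set_pmf \<rho>" for v xz
      using that set_Pi_pmf_subset[of "{1..K}" undefined]
      unfolding \<rho>_def by (fastforce simp: PiE_def extensional_def)
    then show ?thesis unfolding with_Xpot_def Q_def by auto
  qed
  moreover have "indep_rv (measure_pmf Q) (count_space UNIV) (\<lambda>(\<omega>, xz). Zvar \<omega>)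
    (count_space UNIV) (\<lambda>(\<omega>, xz). (Ypot False \<omega>, Ypot True \<omega>, xz))"
    unfolding indep_rv_pmf_iff
  proof (intro allI)
    fix A and B :: "(bool \<times> bool \<times> (nat \<Rightarrow> bool)) set"
    define B' where "B' = {((a, b), xz). (a, b, xz) \<in> B}"
    let ?V = "(\<lambda>(\<omega>, xz). Zvar \<omega>) -` A :: (state \<times> (nat \<Rightarrow> bool)) set"
    let ?W = "(\<lambda>(\<omega>, xz). (Ypot False \<omega>, Ypot True \<omega>, xz)) -` B"
    let ?f = "\<lambda>(z, v, xz). ((z, xz z, v), xz) :: state \<times> (nat \<Rightarrow> bool)"
    have "measure_pmf.prob Q (?V \<inter> ?W) = measure_pmf.prob \<zeta> A * measure_pmf.prob \<rho> B'"
      unfolding product[symmetric] Q_def measure_map_pmf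
      by (rule arg_cong[where f="measure _"]) (auto simp: B'_def)
    moreover have "measure_pmf.prob Q ?V = measure_pmf.prob \<zeta> A"
    proof -
      have "?f -` ?V = {(z, r). z \<in> A \<and> r \<in> UNIV}" by auto
      then show ?thesis using product[of A UNIV] unfolding Q_def measure_map_pmf by simp
    qed
    moreover have "measure_pmf.prob Q ?W = measure_pmf.prob \<rho> B'"
    proof -
      have "?f -` ?W = {(z, r). z \<in> UNIV \<and> r \<in> B'}" by (auto simp: B'_def)
      then show ?thesis using product[of UNIV B'] unfolding Q_def measure_map_pmf by simp
    qed
    ultimately show "measure_pmf.prob Q (?V \<inter> ?W) = measure_pmf.prob Q ?V * measure_pmf.prob Q ?W"
      by simp
  qed
  ultimately have "P \<in> M1 K"
    unfolding M1_def mem_Collect_eq instrument_ok_def map_Zvar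
    using \<zeta> P_def[symmetric] by blast
  moreover have "measure_pmf.prob P {\<omega>. Zvar \<omega> = z \<and> Xvar \<omega> = x \<and> Ypot x \<omega> = y} =
      pmf \<zeta> z * (\<Sum>v | (if x then snd v else fst v) = y. pmf \<pi> v * pmf (bernoulli_pmf (c z v)) x)"
    if z: "z \<in> {1..K}" for z x y
  proof -
    let ?S = "{v. (if x then snd v else fst v) = y}"
    define \<rho>\<^sub>z where "\<rho>\<^sub>z = map_pmf (\<lambda>(v, xz). (v, xz z)) \<rho>"
    have \<rho>\<^sub>z: "\<rho>\<^sub>z = bind_pmf \<pi> (\<lambda>v. map_pmf (Pair v) (bernoulli_pmf (c z v)))"
    proof -
      have "\<rho>\<^sub>z = bind_pmf \<pi> (\<lambda>v. map_pmf (Pair v) (map_pmf (\<lambda>xz. xz z)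
        (Pi_pmf {1..K} undefined (\<lambda>k. bernoulli_pmf (c k v)))))"
        by (simp add: \<rho>\<^sub>z_def \<rho>_def map_bind_pmf map_pmf_comp)
      then show ?thesis using z by (simp add: Pi_pmf_component)
    qed
    have pmf_\<rho>\<^sub>z: "pmf \<rho>\<^sub>z (v, x) = pmf \<pi> v * pmf (bernoulli_pmf (c z v)) x" for v
    proof -
      have "pmf (map_pmf (Pair u) (bernoulli_pmf (c z u))) (v, x) =
        (if u = v then pmf (bernoulli_pmf (c z v)) x else 0)" for u
        by (cases "u = v") (auto simp: pmf_map_inj' inj_on_def pmf_eq_0_set_pmf)
      then show ?thesis
        unfolding \<rho>\<^sub>z pmf_bind
        by (subst integral_measure_pmf_real[of "{v}"]) (auto split: if_splits)
    qed
    have "measure_pmf.prob P {\<omega>. Zvar \<omega> = z \<and> Xvar \<omega> = x \<and> Ypot x \<omega> = y} =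
      measure_pmf.prob (pair_pmf \<zeta> \<rho>) {(z', r). z' \<in> {z} \<and> r \<in> (\<lambda>(v, xz). (v, xz z)) -` (?S \<times> {x})}"
      unfolding P_def Q_def measure_map_pmf
      by (rule arg_cong[where f="measure _"]) auto
    also have "\<dots> = pmf \<zeta> z * measure_pmf.prob \<rho>\<^sub>z (?S \<times> {x})"
      unfolding product by (simp add: \<rho>\<^sub>z_def measure_pmf_single)
    also have "measure_pmf.prob \<rho>\<^sub>z (?S \<times> {x}) = (\<Sum>v\<in>?S. pmf \<rho>\<^sub>z (v, x))"
      by (subst measure_measure_pmf_finite) (auto simp: sum.cartesian_product')
    finally show ?thesis by (simp add: pmf_\<rho>\<^sub>z)
  qed
  ultimately show thesis using that map_Zvar map_Y by blast
qed

text \<open>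
  Sharpness and variation independence rest on this lemma: given the observed distributions, any two
  response margins that separately satisfy the bounds occur together in the smallest model.
\<close>

lemma M1_realises_marginals:
  assumes K: "K \<ge> 1" and P: "instrument_ok K P"
    and q: "\<And>i. q i False + q i True = 1" "\<And>i j. q i j \<le> g K (observed P) i j"
  obtains P' where "P' \<in> M1 K" "same_observed K P' P" "\<And>i j. prob_Ypot P' i j = q i j"
proof -
  obtain r where r: "\<And>a b. 0 \<le> r a b"
    "\<And>a. r a False + r a True = q False a" "\<And>b. r False b + r True b = q True b"
    "\<And>z a b. z \<in> {1..K} \<Longrightarrow> r a b \<le> observed P z False a + observed P z True b"
    using response_law_exists[OF K, of "observed P" q] observed_nonneg observed_sum[OF P] q by metis
  have r_sum: "r False False + r False True + r True False + r True True = 1"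
    using r(2)[of False] r(2)[of True] q(1)[of False] by simp
  have obs_le: "observed P z i j \<le> q i j" if z: "z \<in> {1..K}" for z i j
  proof -
    have "q i (\<not> j) \<le> observed P z i (\<not> j) + (observed P z (\<not> i) False + observed P z (\<not> i) True)"
      using q(2)[of i "\<not> j"] z unfolding le_g_iff[OF K] by blast
    then show ?thesis using q(1)[of i] observed_sum[OF P z] by (cases i; cases j) auto
  qed
  have "\<exists>w. (\<forall>a b. 0 \<le> w a b \<and> w a b \<le> r a b) \<and>
      (\<forall>a. (r a False - w a False) + (r a True - w a True) = observed P z False a) \<and>
      (\<forall>b. w False b + w True b = observed P z True b)" if z: "z \<in> {1..K}" for z
  proof -
    have "observed P z False a \<le> r a False + r a True" "observed P z True b \<le> r False b + r True b"
      for a b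
      using obs_le[OF z] r(2,3) by auto
    then show ?thesis
      using treatment_law_exists[of "observed P z" r] observed_nonneg observed_sum[OF P z]
        r(1) r_sum r(4)[OF z] by metis
  qed
  then obtain w where w: "\<And>z a b. z \<in> {1..K} \<Longrightarrow> 0 \<le> w z a b"
    "\<And>z a b. z \<in> {1..K} \<Longrightarrow> w z a b \<le> r a b"
    "\<And>z a. z \<in> {1..K} \<Longrightarrow> (r a False - w z a False) + (r a True - w z a True) = observed P z False a"
    "\<And>z b. z \<in> {1..K} \<Longrightarrow> w z False b + w z True b = observed P z True b"
    by metis
  define \<pi> where "\<pi> = embed_pmf (\<lambda>(a, b). r a b)"
  have pmf_\<pi>: "pmf \<pi> (a, b) = r a b" for a b
  proof -
    have UNIV_pairs: "(UNIV :: (bool \<times> bool) set) = {(False, False), (False, True), (True, False), (True, True)}"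
      by auto
    have "(\<integral>\<^sup>+ v. ennreal (case v of (a, b) \<Rightarrow> r a b) \<partial>count_space UNIV) =
      ennreal (\<Sum>v\<in>UNIV. case v of (a, b) \<Rightarrow> r a b)"
      by (subst nn_integral_count_space_finite) (auto simp: r(1) intro!: sum_ennreal)
    also have "(\<Sum>v\<in>UNIV. case v of (a, b) \<Rightarrow> r a b) = 1"
      unfolding UNIV_pairs using r_sum by simp
    finally have "(\<integral>\<^sup>+ v. ennreal (case v of (a, b) \<Rightarrow> r a b) \<partial>count_space UNIV) = 1" by simp
    then show ?thesis
      unfolding \<pi>_def by (subst pmf_embed_pmf) (auto simp: r(1))
  qed
  \<comment> \<open>The conditional probability of \<open>X(z) = 1\<close> given the response type. Where \<open>r\<close> vanishes so does
    \<open>w\<close>, and the value 0 given to the quotient is harmless.\<close>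
  define c where "c z v = w z (fst v) (snd v) / r (fst v) (snd v)" for z v
  have "set_pmf (map_pmf Zvar P) = {1..K}" using P by (simp add: instrument_ok_def)
  then obtain P' where P': "P' \<in> M1 K" "map_pmf Zvar P' = map_pmf Zvar P"
    "map_pmf (\<lambda>\<omega>. (Ypot False \<omega>, Ypot True \<omega>)) P' = \<pi>"
    "\<And>z x y. z \<in> {1..K} \<Longrightarrow>
      measure_pmf.prob P' {\<omega>. Zvar \<omega> = z \<and> Xvar \<omega> = x \<and> Ypot x \<omega> = y} =
      pmf (map_pmf Zvar P) z *
        (\<Sum>v | (if x then snd v else fst v) = y. pmf \<pi> v * pmf (bernoulli_pmf (c z v)) x)"
    by (rule M1_from_response_law[where \<pi> = \<pi> and c = c]) (rule that)
  have bern: "r a b * pmf (bernoulli_pmf (c z (a, b))) x = (if x then w z a b else r a b - w z a b)"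
    if z: "z \<in> {1..K}" for z a b x
  proof -
    have "0 \<le> c z (a, b)" "c z (a, b) \<le> 1"
      using w(1,2)[OF z, of a b] r(1)[of a b] by (auto simp: c_def divide_le_eq_1)
    moreover have "r a b * c z (a, b) = w z a b"
      using w(1,2)[OF z, of a b] by (auto simp: c_def)
    ultimately show ?thesis by (cases x) (auto simp: algebra_simps)
  qed
  have same: "same_observed K P' P"
    unfolding same_observed_def
  proof (intro ballI allI)
    fix z x y assume z: "z \<in> {1..K}"
    have S: "{v :: bool \<times> bool. (if x then snd v else fst v) = y} =
      (if x then {(False, y), (True, y)} else {(y, False), (y, True)})"
      by auto
    have "(\<Sum>v | (if x then snd v else fst v) = y. pmf \<pi> v * pmf (bernoulli_pmf (c z v)) x) =
      observed P z x y"
      unfolding S using w(3)[OF z, of y] w(4)[OF z, of y]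
      by (cases x) (simp_all add: pmf_\<pi> bern[OF z])
    moreover have "measure_pmf.prob P' {\<omega>. Zvar \<omega> = z} = pmf (map_pmf Zvar P) z"
      unfolding P'(2)[symmetric] by (simp add: pmf_map vimage_def)
    moreover have "pmf (map_pmf Zvar P) z > 0"
      using P z unfolding instrument_ok_def by (metis pmf_positive)
    ultimately show "observed P' z x y = observed P z x y"
      using P'(4)[OF z, of x y] by (simp add: observed_eq[of P'])
  qed
  have "prob_Ypot P' i j = q i j" for i j
  proof -
    have "prob_Ypot P' i j = measure_pmf.prob \<pi> (if i then {(False, j), (True, j)} else {(j, False), (j, True)})"
      unfolding P'(3)[symmetric] measure_map_pmf prob_Ypot_eq
      by (rule arg_cong[where f="measure _"]) auto
    also have "\<dots> = q i j"
      using r(2)[of j] r(3)[of j]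
      by (cases i) (simp_all add: measure_measure_pmf_finite pmf_\<pi>)
    finally show ?thesis .
  qed
  then show thesis using that P'(1) same by blast
qed

section \<open>Conditional probabilities of events\<close>

lemma cond_prob_indep:
  assumes M: "prob_space M" and F: "subalgebra M F" and A: "A \<in> sets M"
    and ind: "\<And>B. B \<in> sets F \<Longrightarrow> measure M (A \<inter> B) = measure M A * measure M B"
  shows "AE \<omega> in M. real_cond_exp M F (indicator A) \<omega> = measure M A"
proof -
  interpret prob_space M by (rule M)
  interpret finite_measure_subalgebra M F by unfold_locales (rule F)
  have sets_F: "B \<in> sets M" if "B \<in> sets F" for B
    using F that by (auto simp: subalgebra_def)
  show ?thesis
  proof (rule real_cond_exp_charact)
    fix B assume B: "B \<in> sets F"
    have "(\<integral>x\<in>B. indicator A x \<partial>M) = (\<integral>x. indicator (A \<inter> B) x \<partial>M)"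
      unfolding set_lebesgue_integral_def
      by (rule Bochner_Integration.integral_cong) (auto simp: indicator_def)
    also have "\<dots> = measure M A * measure M B"
      using A sets_F[OF B] ind[OF B] by simp
    also have "\<dots> = (\<integral>x\<in>B. measure M A \<partial>M)"
      using sets_F[OF B] by (simp add: set_lebesgue_integral_def)
    finally show "(\<integral>x\<in>B. indicator A x \<partial>M) = (\<integral>x\<in>B. measure M A \<partial>M)" .
  qed (use A in \<open>auto intro!: integrable_real_indicator simp: emeasure_eq_measure\<close>)
qed

lemma cond_prob_Un:
  assumes M: "prob_space M" and F: "subalgebra M F"
    and A: "A \<in> sets M" "B \<in> sets M" "A \<inter> B = {}"
  shows "AE \<omega> in M. real_cond_exp M F (indicator (A \<union> B)) \<omega> =
    real_cond_exp M F (indicator A) \<omega> + real_cond_exp M F (indicator B) \<omega>"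
proof -
  interpret prob_space M by (rule M)
  interpret finite_measure_subalgebra M F by unfold_locales (rule F)
  have "(indicator (A \<union> B) :: _ \<Rightarrow> real) = (\<lambda>x. indicator A x + indicator B x)"
    using A(3) by (auto simp: indicator_def fun_eq_iff)
  then show ?thesis using real_cond_exp_add[of "indicator A" "indicator B"] A
    by (simp add: integrable_real_indicator emeasure_eq_measure)
qed

lemma cond_prob_nonneg:
  assumes M: "prob_space M" and F: "subalgebra M F" and A: "A \<in> sets M"
  shows "AE \<omega> in M. 0 \<le> real_cond_exp M F (indicator A) \<omega>"
proof -
  interpret prob_space M by (rule M)
  interpret finite_measure_subalgebra M F by unfold_locales (rule F)
  show ?thesis using A by (intro real_cond_exp_pos) auto
qed

lemma cond_prob_integral:
  assumes M: "prob_space M" and F: "subalgebra M F" and A: "A \<in> sets M"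
  shows "integrable M (real_cond_exp M F (indicator A))"
    and "(\<integral>\<omega>. real_cond_exp M F (indicator A) \<omega> \<partial>M) = measure M A"
proof -
  interpret prob_space M by (rule M)
  interpret finite_measure_subalgebra M F by unfold_locales (rule F)
  have "integrable M (indicator A :: _ \<Rightarrow> real)"
    using A by (simp add: integrable_real_indicator emeasure_eq_measure)
  from real_cond_exp_int[OF this] A
  show "integrable M (real_cond_exp M F (indicator A))"
    and "(\<integral>\<omega>. real_cond_exp M F (indicator A) \<omega> \<partial>M) = measure M A" by auto
qed

section \<open>The latent variable model\<close>

text \<open>
  The second bound conditionally on \<open>U\<close>: here \<open>a\<close>, \<open>b0\<close>, \<open>b1\<close> are the conditional
  probabilities of \<open>Y(x\<^sub>i) = j\<close>, \<open>Y(x\<^sub>1\<^sub>-\<^sub>i) = 0\<close>, \<open>Y(x\<^sub>1\<^sub>-\<^sub>i) = 1\<close>, and \<open>x\<close>,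
  \<open>x'\<close> those of \<open>X = i\<close> at two values of the instrument.
\<close>

lemma latent_pointwise_bound:
  fixes a b0 b1 x x' :: real
  assumes "0 \<le> a" "a \<le> 1" "0 \<le> b0" "0 \<le> b1" "b0 + b1 = 1" "0 \<le> x" "x \<le> 1" "0 \<le> x'" "x' \<le> 1"
  shows "a \<le> a * x + b0 * (1 - x) + a * x' + b1 * (1 - x')"
proof (cases "x + x' \<ge> 1")
  case True
  then have "0 \<le> a * (x + x' - 1)" "0 \<le> b0 * (1 - x)" "0 \<le> b1 * (1 - x')" using assms by simp_all
  then show ?thesis by (simp add: algebra_simps)
next
  case False
  then have "0 \<le> (1 - a) * (1 - x - x')" using assms by simp
  moreover have "0 \<le> b0 * x'" "0 \<le> b1 * x" using assms by simp_all
  moreover have "x * b0 + x * b1 = x" "x' * b0 + x' * b1 = x'" using assms(5)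
    by (simp_all flip: distrib_left)
  ultimately show ?thesis using assms(5) by (simp add: algebra_simps)
qed

text \<open>
  The pair \<open>(Y(x\<^sub>0), Y(x\<^sub>1))\<close> itself, encoded by an injection \<open>e\<close> into the type \<open>'u\<close>, serves as
  \<open>U\<close>: each \<open>Y(x\<^sub>i)\<close> is a function of it, hence conditionally independent of everything.
  Four elements of \<open>'u\<close> suffice. The range of \<open>e\<close> is taken as the whole space of \<open>U\<close>, so that the
  product with the countable type of states is discrete.
\<close>

lemma M2_subset_M4:
  assumes inf: "infinite (UNIV :: 'u set)"
  shows "M2 K \<subseteq> M4 TYPE('u) K"
proof
  fix P assume "P \<in> M2 K"
  then have P: "instrument_ok K P"
    and ind: "indep_rv (measure_pmf P) (count_space UNIV) Zvar
      (count_space UNIV) (\<lambda>\<omega>. (Ypot False \<omega>, Ypot True \<omega>))"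
    unfolding M2_def by auto
  obtain e :: "bool \<times> bool \<Rightarrow> 'u" where e: "inj e"
  proof -
    obtain S :: "'u set" where S: "finite S" "card S = card (UNIV :: (bool \<times> bool) set)"
      using infinite_arbitrarily_large[OF inf] by metis
    have "\<exists>e. e ` (UNIV :: (bool \<times> bool) set) \<subseteq> S \<and> inj e"
      using card_le_inj[OF _ S(1), of "UNIV :: (bool \<times> bool) set"] S(2) by auto
    then show thesis using that by blast
  qed
  define N where "N = count_space (range e)"
  define T where "T = (\<lambda>\<omega>. (e (Ypot False \<omega>, Ypot True \<omega>), \<omega>))"
  define Q where "Q = distr (measure_pmf P) (N \<Otimes>\<^sub>M count_space UNIV) T"
  have product: "N \<Otimes>\<^sub>M count_space (UNIV :: state set) = count_space (range e \<times> UNIV)"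
    unfolding N_def by (rule pair_measure_countable) auto
  have T: "T \<in> measurable (measure_pmf P) (N \<Otimes>\<^sub>M count_space UNIV)"
    unfolding product T_def by auto
  have Q_prob: "prob_space Q"
    unfolding Q_def using T by (rule measure_pmf.prob_space_distr)
  interpret prob_space Q by (rule Q_prob)
  have space_Q: "space Q = range e \<times> UNIV" and sets_Q: "sets Q = Pow (range e \<times> UNIV)"
    unfolding Q_def product by simp_all
  have measure_Q: "measure Q A = measure_pmf.prob P (T -` A)" if "A \<subseteq> range e \<times> UNIV" for A
  proof -
    have "A \<in> sets (N \<Otimes>\<^sub>M count_space UNIV)" using that unfolding product by simp
    then show ?thesis unfolding Q_def using T by (simp add: measure_distr)
  qed
  have measurable_Q: "f \<in> measurable Q (count_space UNIV)" for f :: "'u \<times> state \<Rightarrow> 'z"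
    by (rule measurableI) (auto simp: sets_Q space_Q)
  have fst_N: "fst \<in> measurable Q N"
    by (rule measurableI) (auto simp: sets_Q space_Q N_def)
  let ?F = "vimage_algebra (space Q) fst N"
  have F: "subalgebra Q ?F"
  proof -
    have "sets ?F = {fst -` A \<inter> space Q | A. A \<in> sets N}"
      by (rule sets_vimage_algebra2) (auto simp: space_Q N_def)
    then show ?thesis using fst_N by (auto simp: subalgebra_def)
  qed
  interpret finite_measure_subalgebra Q ?F by unfold_locales (rule F)
  have "distr Q (count_space UNIV) snd = measure_pmf P"
    unfolding Q_def by (subst distr_distr) (use T in \<open>auto simp: T_def comp_def product distr_id2\<close>)
  moreover have "indep_rv Q N fst (count_space UNIV) (\<lambda>(u, \<omega>). Zvar \<omega>)"
    unfolding indep_rv_def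
  proof (intro conjI indep_setI fst_N measurable_Q)
    fix a b assume "a \<in> {fst -` A \<inter> space Q | A. A \<in> sets N}"
      "b \<in> {(\<lambda>(u, \<omega>). Zvar \<omega>) -` B \<inter> space Q | B. B \<in> sets (count_space UNIV)}"
    then obtain A B where ab: "a = fst -` A \<inter> space Q" "b = (\<lambda>(u, \<omega>). Zvar \<omega>) -` B \<inter> space Q"
      by auto
    have "T -` a = (\<lambda>\<omega>. (Ypot False \<omega>, Ypot True \<omega>)) -` (e -` A)" "T -` b = Zvar -` B"
      unfolding ab by (auto simp: T_def space_Q)
    moreover have "T -` (a \<inter> b) = T -` b \<inter> T -` a" by auto
    moreover have "a \<subseteq> range e \<times> UNIV" "b \<subseteq> range e \<times> UNIV" using ab space_Q by auto
    ultimately show "prob (a \<inter> b) = prob a * prob b"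
      using ind[unfolded indep_rv_pmf_iff, rule_format, of B "e -` A"]
      by (simp add: measure_Q le_infI1 mult.commute)
  qed (auto simp: sets_Q space_Q)
  moreover have "cond_indep_rv Q
           (count_space UNIV) (\<lambda>(u, \<omega>). Ypot i \<omega>)
           (count_space UNIV) (\<lambda>(u, \<omega>). (Xvar \<omega>, Zvar \<omega>)) N fst" for i
    unfolding cond_indep_rv_def
  proof (intro conjI ballI measurable_Q fst_N)
    fix A :: "bool set" and B :: "(bool \<times> nat) set"
    let ?A = "(\<lambda>(u, \<omega>). Ypot i \<omega>) -` A \<inter> space Q :: ('u \<times> state) set"
    let ?B = "(\<lambda>(u, \<omega>). (Xvar \<omega>, Zvar \<omega>)) -` B \<inter> space Q :: ('u \<times> state) set"
    \<comment> \<open>The event that \<open>Y(x\<^sub>i)\<close> lies in \<open>A\<close>, expressed through \<open>U\<close>; the two expressions agree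
      on the range of \<open>T\<close> only, hence almost surely.\<close>
    define A' where "A' = fst -` (e ` {v. (if i then snd v else fst v) \<in> A}) \<inter> space Q"
    have A'_F: "A' \<in> sets ?F" unfolding A'_def
      by (rule in_vimage_algebra) (auto simp: N_def)
    have AE_T: "AE \<omega> in Q. \<omega> \<in> range T"
    proof -
      have "{v \<in> space (N \<Otimes>\<^sub>M count_space UNIV). v \<in> range T} \<in> sets (N \<Otimes>\<^sub>M count_space UNIV)"
        unfolding product by auto
      then show ?thesis unfolding Q_def by (subst AE_distr_iff[OF T]) auto
    qed
    have A_A': "\<omega> \<in> ?A \<longleftrightarrow> \<omega> \<in> A'" if "\<omega> \<in> range T" for \<omega>
      using that by (auto simp: A'_def T_def inj_eq[OF e])
    have [measurable]: "?A \<in> sets Q" "?B \<in> sets Q" "A' \<in> sets Q"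
      by (auto simp: sets_Q space_Q A'_def)
    have AE_A: "AE \<omega> in Q. indicator ?A \<omega> = (indicator A' \<omega> :: real)"
      using AE_T by eventually_elim (simp only: indicator_def A_A')
    then have AE_AB: "AE \<omega> in Q. indicator (?A \<inter> ?B) \<omega> = (indicator A' \<omega> * indicator ?B \<omega> :: real)"
      by eventually_elim (simp only: indicator_inter_arith)
    have cond_A: "AE \<omega> in Q. real_cond_exp Q ?F (indicator ?A) \<omega> = real_cond_exp Q ?F (indicator A') \<omega>"
      by (rule real_cond_exp_cong[OF AE_A]) auto
    have cond_A': "AE \<omega> in Q. real_cond_exp Q ?F (indicator A') \<omega> = indicator A' \<omega>"
      by (rule real_cond_exp_F_meas)
        (use A'_F in \<open>auto intro!: integrable_real_indicator simp: emeasure_eq_measure\<close>)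
    have cond_AB: "AE \<omega> in Q. real_cond_exp Q ?F (indicator (?A \<inter> ?B)) \<omega> =
      real_cond_exp Q ?F (\<lambda>\<omega>. indicator A' \<omega> * indicator ?B \<omega>) \<omega>"
      by (rule real_cond_exp_cong[OF AE_AB]) auto
    have pull_out: "AE \<omega> in Q. real_cond_exp Q ?F (\<lambda>\<omega>. indicator A' \<omega> * indicator ?B \<omega>) \<omega> =
      indicator A' \<omega> * real_cond_exp Q ?F (indicator ?B) \<omega>"
      by (rule real_cond_exp_mult) (use A'_F in \<open>auto intro!: integrable_real_indicator
          simp: indicator_inter_arith[symmetric] emeasure_eq_measure\<close>)
    have events: "(\<lambda>(u, \<omega>). Ypot i \<omega>) -` A \<inter> (\<lambda>(u, \<omega>). (Xvar \<omega>, Zvar \<omega>)) -` B \<inter> space Q = ?A \<inter> ?B"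
      by auto
    show "AE \<omega> in Q.
        real_cond_exp Q ?F (indicator ((\<lambda>(u, \<omega>). Ypot i \<omega>) -` A \<inter> (\<lambda>(u, \<omega>). (Xvar \<omega>, Zvar \<omega>)) -` B \<inter> space Q)) \<omega> =
        real_cond_exp Q ?F (indicator ?A) \<omega> * real_cond_exp Q ?F (indicator ?B) \<omega>"
      unfolding events using cond_A cond_A' cond_AB pull_out by eventually_elim simp
  qed
  moreover have "sets Q = sets (N \<Otimes>\<^sub>M count_space UNIV)" by (simp add: Q_def)
  ultimately show "P \<in> M4 TYPE('u) K"
    unfolding M4_def using P Q_prob by blast
qed

text \<open>
  \<open>E S\<close> is the conditional probability of the event \<open>S\<close> given \<open>U\<close>. As \<open>U\<close> and \<open>Z\<close> are
  independent, \<open>E\<close> of \<open>Z = z\<close> is the constant \<open>\<zeta> z = P(Z = z)\<close>, so that \<open>E\<close> of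
  \<open>X = i, Z = z\<close> divided by \<open>\<zeta> z\<close> is the probability of \<open>X = i\<close> given \<open>U\<close> and \<open>Z = z\<close>.
  By conditional independence, \<open>E\<close> factorises on the observed cells. Both bounds hold pointwise
  for these conditional probabilities and are then integrated.
\<close>

lemma M4_bound:
  assumes K: "K \<ge> 1" and "P \<in> M4 TYPE('u) K"
  shows "prob_Ypot P i j \<le> g K (observed P) i j"
proof -
  obtain N :: "'u measure" and Q :: "('u \<times> state) measure" where P: "instrument_ok K P"
    and Q: "prob_space Q" "sets Q = sets (N \<Otimes>\<^sub>M count_space UNIV)"
      "distr Q (count_space UNIV) snd = measure_pmf P"
    and UZ: "indep_rv Q N fst (count_space UNIV) (\<lambda>(u, \<omega>). Zvar \<omega>)"
    and CI: "\<And>i. cond_indep_rv Q (count_space UNIV) (\<lambda>(u, \<omega>). Ypot i \<omega>)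
           (count_space UNIV) (\<lambda>(u, \<omega>). (Xvar \<omega>, Zvar \<omega>)) N fst"
    using assms(2) unfolding M4_def mem_Collect_eq by blast
  interpret prob_space Q by (rule Q)
  define ev where "ev S = {v \<in> space Q. S (snd v)}" for S :: "state \<Rightarrow> bool"
  define F where "F = vimage_algebra (space Q) fst N"
  define E where "E S = real_cond_exp Q F (indicator (ev S))" for S
  have snd_Q: "snd \<in> measurable Q (count_space UNIV)"
    unfolding measurable_cong_sets[OF Q(2) refl] by simp
  have fst_Q: "fst \<in> measurable Q N"
    unfolding measurable_cong_sets[OF Q(2) refl] by simp
  have ev_sets: "ev S \<in> sets Q" for S
    using measurable_sets[OF snd_Q, of "Collect S"] by (simp add: ev_def vimage_def Int_def conj_commute)
  have ev_prob: "measure_pmf.prob P {\<omega>. S \<omega>} = prob (ev S)" for S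
    unfolding Q(3)[symmetric] using snd_Q
    by (subst measure_distr) (auto simp: ev_def intro!: arg_cong[where f="prob"])
  have sets_F: "sets F = {fst -` A \<inter> space Q | A. A \<in> sets N}"
    unfolding F_def by (rule sets_vimage_algebra2) (rule Pi_I, rule measurable_space[OF fst_Q])
  have F: "subalgebra Q F"
    using sets_F fst_Q by (auto simp: subalgebra_def F_def)
  define \<zeta> where "\<zeta> z = prob (ev (\<lambda>\<omega>. Zvar \<omega> = z))" for z
  have \<zeta>_pos: "0 < \<zeta> z" if "z \<in> {1..K}" for z
    using Zvar_prob_pos[OF P that] by (simp add: \<zeta>_def ev_prob)
  have E_Z: "AE v in Q. E (\<lambda>\<omega>. Zvar \<omega> = z) v = \<zeta> z" for z
    unfolding E_def \<zeta>_def
  proof (rule cond_prob_indep[OF Q(1) F ev_sets])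
    fix B assume "B \<in> sets F"
    then have "B \<in> {fst -` A \<inter> space Q | A. A \<in> sets N}" unfolding sets_F .
    moreover have "ev (\<lambda>\<omega>. Zvar \<omega> = z) \<in> {(\<lambda>(u, \<omega>). Zvar \<omega>) -` B \<inter> space Q | B. B \<in> sets (count_space UNIV)}"
      by (auto simp: ev_def intro!: exI[of _ "{z}"])
    ultimately show "prob (ev (\<lambda>\<omega>. Zvar \<omega> = z) \<inter> B) = prob (ev (\<lambda>\<omega>. Zvar \<omega> = z)) * prob B"
      using indep_setD[OF conjunct2[OF conjunct2[OF UZ[unfolded indep_rv_def]]], of B
          "ev (\<lambda>\<omega>. Zvar \<omega> = z)"]
      by (simp only: Int_commute mult.commute)
  qed
  have E_split: "AE v in Q. E S v = E (\<lambda>\<omega>. S \<omega> \<and> \<not> T \<omega>) v + E (\<lambda>\<omega>. S \<omega> \<and> T \<omega>) v" for S T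
  proof -
    have "ev S = ev (\<lambda>\<omega>. S \<omega> \<and> \<not> T \<omega>) \<union> ev (\<lambda>\<omega>. S \<omega> \<and> T \<omega>)" by (auto simp: ev_def)
    then show ?thesis unfolding E_def
      using cond_prob_Un[OF Q(1) F ev_sets ev_sets, of "\<lambda>\<omega>. S \<omega> \<and> \<not> T \<omega>" "\<lambda>\<omega>. S \<omega> \<and> T \<omega>"]
      by (auto simp: ev_def)
  qed
  have E_nonneg: "AE v in Q. 0 \<le> E S v" for S
    unfolding E_def by (rule cond_prob_nonneg[OF Q(1) F ev_sets])
  have E_int: "integrable Q (E S)" "(\<integral>v. E S v \<partial>Q) = prob (ev S)" for S
    unfolding E_def by (rule cond_prob_integral[OF Q(1) F ev_sets])+
  have E_X: "AE v in Q. \<zeta> z = E (\<lambda>\<omega>. Xvar \<omega> = i \<and> Zvar \<omega> = z) v + E (\<lambda>\<omega>. Xvar \<omega> = (\<not> i) \<and> Zvar \<omega> = z) v"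
    for z
  proof -
    have "AE v in Q. E (\<lambda>\<omega>. Zvar \<omega> = z) v =
      E (\<lambda>\<omega>. Xvar \<omega> = i \<and> Zvar \<omega> = z) v + E (\<lambda>\<omega>. Xvar \<omega> = (\<not> i) \<and> Zvar \<omega> = z) v"
      using E_split[of "\<lambda>\<omega>. Zvar \<omega> = z" "\<lambda>\<omega>. Xvar \<omega> = (\<not> i)"] by (simp add: conj_commute)
    then show ?thesis using E_Z[of z] by eventually_elim simp
  qed
  have E_Y: "AE v in Q. 1 = E (\<lambda>\<omega>. Ypot k \<omega> = False) v + E (\<lambda>\<omega>. Ypot k \<omega> = True) v" for k
  proof -
    have "AE v in Q. E (\<lambda>_. True) v = prob (space Q)"
      unfolding E_def ev_def by simp (rule cond_prob_indep[OF Q(1) F],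
        auto simp: sets_F prob_space intro!: arg_cong[where f="prob"])
    with E_split[of "\<lambda>_. True" "Ypot k"] show ?thesis
      by eventually_elim (simp add: prob_space)
  qed
  have E_CI: "AE v in Q. E (\<lambda>\<omega>. Zvar \<omega> = z \<and> Xvar \<omega> = x \<and> Ypot k \<omega> = y) v =
    E (\<lambda>\<omega>. Ypot k \<omega> = y) v * E (\<lambda>\<omega>. Xvar \<omega> = x \<and> Zvar \<omega> = z) v" for z x k y
  proof -
    have events: "(\<lambda>(u, \<omega>). Ypot k \<omega>) -` {y} \<inter> (\<lambda>(u, \<omega>). (Xvar \<omega>, Zvar \<omega>)) -` {(x, z)} \<inter> space Q =
      ev (\<lambda>\<omega>. Zvar \<omega> = z \<and> Xvar \<omega> = x \<and> Ypot k \<omega> = y)"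
      "(\<lambda>(u, \<omega>). Ypot k \<omega>) -` {y} \<inter> space Q = ev (\<lambda>\<omega>. Ypot k \<omega> = y)"
      "(\<lambda>(u, \<omega>). (Xvar \<omega>, Zvar \<omega>)) -` {(x, z)} \<inter> space Q = ev (\<lambda>\<omega>. Xvar \<omega> = x \<and> Zvar \<omega> = z)"
      unfolding ev_def set_eq_iff Int_iff vimage_eq case_prod_unfold by (simp_all add: conj_ac)
    have "\<forall>A\<in>sets (count_space UNIV). \<forall>B\<in>sets (count_space UNIV). AE v in Q.
        real_cond_exp Q F (indicator ((\<lambda>(u, \<omega>). Ypot k \<omega>) -` A \<inter>
          (\<lambda>(u, \<omega>). (Xvar \<omega>, Zvar \<omega>)) -` B \<inter> space Q)) v =
        real_cond_exp Q F (indicator ((\<lambda>(u, \<omega>). Ypot k \<omega>) -` A \<inter> space Q)) v *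
        real_cond_exp Q F (indicator ((\<lambda>(u, \<omega>). (Xvar \<omega>, Zvar \<omega>)) -` B \<inter> space Q)) v"
      using CI[of k] unfolding cond_indep_rv_def F_def by (elim conjE)
    from this[rule_format, of "{y}" "{(x, z)}"] show ?thesis
      unfolding events E_def by simp
  qed
  define cell where "cell z x y = (\<lambda>\<omega>. Zvar \<omega> = z \<and> Xvar \<omega> = x \<and> Ypot x \<omega> = y)" for z x y
  have obs: "observed P z x y = prob (ev (cell z x y)) / \<zeta> z" for z x y
    unfolding observed_eq ev_prob cell_def \<zeta>_def ..
  have pY: "prob_Ypot P i j = (\<integral>v. E (\<lambda>\<omega>. Ypot i \<omega> = j) v \<partial>Q)"
    unfolding prob_Ypot_eq ev_prob E_int ..
  have E_le_1: "AE v in Q. E (\<lambda>\<omega>. Ypot i \<omega> = j) v \<le> 1"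
    using E_Y[of i] E_nonneg[of "\<lambda>\<omega>. Ypot i \<omega> = False"] E_nonneg[of "\<lambda>\<omega>. Ypot i \<omega> = True"]
    by eventually_elim (cases j, auto)
  show ?thesis
    unfolding le_g_iff[OF K]
  proof (intro conjI ballI impI)
    fix z assume z: "z \<in> {1..K}"
    have "AE v in Q. E (\<lambda>\<omega>. Ypot i \<omega> = j) v \<le>
      E (cell z i j) v / \<zeta> z + (E (cell z (\<not> i) False) v / \<zeta> z + E (cell z (\<not> i) True) v / \<zeta> z)"
      using E_CI[of z i i j] E_CI[of z "\<not> i" "\<not> i" False] E_CI[of z "\<not> i" "\<not> i" True] E_X[of z]
        E_Y[of "\<not> i"] E_le_1 E_nonneg[of "\<lambda>\<omega>. Xvar \<omega> = (\<not> i) \<and> Zvar \<omega> = z"]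
    proof eventually_elim
      case (elim v)
      let ?x = "E (\<lambda>\<omega>. Xvar \<omega> = i \<and> Zvar \<omega> = z) v" and ?x' = "E (\<lambda>\<omega>. Xvar \<omega> = (\<not> i) \<and> Zvar \<omega> = z) v"
      let ?a = "E (\<lambda>\<omega>. Ypot i \<omega> = j) v"
      have "E (cell z (\<not> i) False) v + E (cell z (\<not> i) True) v = ?x'"
        unfolding cell_def using elim by (simp flip: distrib_right)
      moreover have "E (cell z i j) v = ?a * (\<zeta> z - ?x')"
        unfolding cell_def using elim by simp
      moreover have "0 \<le> (1 - ?a) * ?x'" using elim by simp
      ultimately have "?a * \<zeta> z \<le> E (cell z i j) v + (E (cell z (\<not> i) False) v + E (cell z (\<not> i) True) v)"
        by (simp add: algebra_simps)
      then show ?case using \<zeta>_pos[OF z] by (simp add: field_simps)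
    qed
    then have "(\<integral>v. E (\<lambda>\<omega>. Ypot i \<omega> = j) v \<partial>Q) \<le>
      (\<integral>v. E (cell z i j) v / \<zeta> z + (E (cell z (\<not> i) False) v / \<zeta> z + E (cell z (\<not> i) True) v / \<zeta> z) \<partial>Q)"
      by (intro integral_mono_AE) (simp_all add: E_int)
    then show "prob_Ypot P i j \<le>
      observed P z i j + (observed P z (\<not> i) False + observed P z (\<not> i) True)"
      unfolding pY by (simp add: E_int obs)
  next
    fix z z' assume z: "z \<in> {1..K}" "z' \<in> {1..K}"
    have "AE v in Q. E (\<lambda>\<omega>. Ypot i \<omega> = j) v \<le>
      E (cell z i j) v / \<zeta> z + E (cell z (\<not> i) False) v / \<zeta> z +
      E (cell z' i j) v / \<zeta> z' + E (cell z' (\<not> i) True) v / \<zeta> z'"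
      using E_CI[of z i i j] E_CI[of z "\<not> i" "\<not> i" False] E_CI[of z' i i j] E_CI[of z' "\<not> i" "\<not> i" True]
        E_X[of z] E_X[of z'] E_Y[of "\<not> i"] E_le_1 E_nonneg[of "\<lambda>\<omega>. Ypot i \<omega> = j"]
        E_nonneg[of "\<lambda>\<omega>. Ypot (\<not> i) \<omega> = False"] E_nonneg[of "\<lambda>\<omega>. Ypot (\<not> i) \<omega> = True"]
        E_nonneg[of "\<lambda>\<omega>. Xvar \<omega> = i \<and> Zvar \<omega> = z"] E_nonneg[of "\<lambda>\<omega>. Xvar \<omega> = (\<not> i) \<and> Zvar \<omega> = z"]
        E_nonneg[of "\<lambda>\<omega>. Xvar \<omega> = i \<and> Zvar \<omega> = z'"] E_nonneg[of "\<lambda>\<omega>. Xvar \<omega> = (\<not> i) \<and> Zvar \<omega> = z'"]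
    proof eventually_elim
      case (elim v)
      let ?x = "\<lambda>z. E (\<lambda>\<omega>. Xvar \<omega> = i \<and> Zvar \<omega> = z) v / \<zeta> z"
      let ?a = "E (\<lambda>\<omega>. Ypot i \<omega> = j) v"
      let ?b = "\<lambda>y. E (\<lambda>\<omega>. Ypot (\<not> i) \<omega> = y) v"
      have x': "E (\<lambda>\<omega>. Xvar \<omega> = (\<not> i) \<and> Zvar \<omega> = z) v / \<zeta> z = 1 - ?x z"
        "E (\<lambda>\<omega>. Xvar \<omega> = (\<not> i) \<and> Zvar \<omega> = z') v / \<zeta> z' = 1 - ?x z'"
        using elim \<zeta>_pos[OF z(1)] \<zeta>_pos[OF z(2)] by (auto simp: field_simps)
      have "?a \<le> ?a * ?x z + ?b False * (1 - ?x z) + ?a * ?x z' + ?b True * (1 - ?x z')"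
        by (rule latent_pointwise_bound)
          (use elim \<zeta>_pos[OF z(1)] \<zeta>_pos[OF z(2)] in \<open>auto simp: divide_le_eq_1\<close>)
      then show ?case
        unfolding x'[symmetric] cell_def using elim by simp
    qed
    then have "(\<integral>v. E (\<lambda>\<omega>. Ypot i \<omega> = j) v \<partial>Q) \<le>
      (\<integral>v. E (cell z i j) v / \<zeta> z + E (cell z (\<not> i) False) v / \<zeta> z +
      E (cell z' i j) v / \<zeta> z' + E (cell z' (\<not> i) True) v / \<zeta> z' \<partial>Q)"
      by (intro integral_mono_AE) (simp_all add: E_int)
    then show "prob_Ypot P i j \<le> observed P z i j + observed P z (\<not> i) False +
        observed P z' i j + observed P z' (\<not> i) True"
      unfolding pY by (simp add: E_int obs)
  qed
qed

section \<open>Sharp bounds and variation independence\<close>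

theorem theorem2:
  fixes K :: nat and M :: "state pmf set" and P :: "state pmf"
  assumes "K \<ge> 1"
    and "infinite (UNIV :: 'u set)"
    and "M \<in> {M1 K, M2 K, M3 K, M4 TYPE('u) K}"
    and "P \<in> M"
  shows
    "(\<forall>i j. prob_Ypot P i j \<le> g K (observed P) i j) \<and>
     {(prob_Ypot P' False True, prob_Ypot P' True True) | P'. P' \<in> M \<and> same_observed K P' P} =
       {prob_Ypot P' False True | P'. P' \<in> M \<and> same_observed K P' P} \<times>
       {prob_Ypot P' True True | P'. P' \<in> M \<and> same_observed K P' P} \<and>
     (1 - g K (observed P) True False - g K (observed P) False True \<le> ACE P \<and>
      ACE P \<le> g K (observed P) False False + g K (observed P) True True - 1) \<and>
     (\<forall>i j. \<exists>P'\<in>M. same_observed K P' P \<and> prob_Ypot P' i j = g K (observed P) i j) \<and>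
     (\<exists>P'\<in>M. same_observed K P' P \<and>
        ACE P' = 1 - g K (observed P) True False - g K (observed P) False True) \<and>
     (\<exists>P'\<in>M. same_observed K P' P \<and>
        ACE P' = g K (observed P) False False + g K (observed P) True True - 1)"
proof -
  let ?g = "g K (observed P)"
  have M1_M: "M1 K \<subseteq> M"
    using assms(3) M1_subset_M2[of K] M1_subset_M3[of K] M2_subset_M4[OF assms(2), of K] by blast
  have P_ok: "instrument_ok K P"
    using assms(3,4) by (auto simp: M1_def M2_def M3_def M4_def)
  have bound: "prob_Ypot P' i j \<le> ?g i j" if "P' \<in> M" "same_observed K P' P" for P' i j
  proof -
    have "P' \<in> M2 K \<or> P' \<in> M3 K \<or> P' \<in> M4 TYPE('u) K"
      using assms(3) that(1) M1_subset_M2 by blast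
    then have "prob_Ypot P' i j \<le> g K (observed P') i j"
      using M2_bound M3_bound M4_bound assms(1) by blast
    then show ?thesis by (simp only: same_observed_g[OF assms(1) that(2)])
  qed
  have self: "same_observed K P P" by (simp add: same_observed_def)
  have sum: "prob_Ypot P' i False = 1 - prob_Ypot P' i True" for P' i
    using prob_Ypot_sum[of P' i] by simp
  have g_sum: "1 \<le> ?g i False + ?g i True" for i
    using bound[OF assms(4) self, of i False] bound[OF assms(4) self, of i True] sum[of P i] by simp
  have realise: "\<exists>P'\<in>M. same_observed K P' P \<and> prob_Ypot P' False True = q0 \<and> prob_Ypot P' True True = q1"
    if "1 - ?g False False \<le> q0" "q0 \<le> ?g False True" "1 - ?g True False \<le> q1" "q1 \<le> ?g True True"
    for q0 q1
  proof -
    define q where "q i j = (if j then if i then q1 else q0 else 1 - (if i then q1 else q0))" for i j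
    have "q i False + q i True = 1" "q i j \<le> ?g i j" for i j
      using that by (cases i; cases j; simp add: q_def)+
    then obtain P' where "P' \<in> M1 K" "same_observed K P' P" "\<And>i j. prob_Ypot P' i j = q i j"
      using M1_realises_marginals[OF assms(1) P_ok, of q] by metis
    then show ?thesis using M1_M by (auto simp: q_def intro!: bexI[of _ P'])
  qed
  have pair: "\<exists>P'. (prob_Ypot P1 False True, prob_Ypot P2 True True) =
      (prob_Ypot P' False True, prob_Ypot P' True True) \<and> P' \<in> M \<and> same_observed K P' P"
    if "P1 \<in> M" "same_observed K P1 P" "P2 \<in> M" "same_observed K P2 P" for P1 P2
  proof -
    have "1 - ?g False False \<le> prob_Ypot P1 False True" "1 - ?g True False \<le> prob_Ypot P2 True True"
      using bound[OF that(1,2), of False False] bound[OF that(3,4), of True False]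
        sum[of P1 False] sum[of P2 True] by linarith+
    then have "\<exists>P'\<in>M. same_observed K P' P \<and> prob_Ypot P' False True = prob_Ypot P1 False True \<and>
        prob_Ypot P' True True = prob_Ypot P2 True True"
      by (intro realise bound that)
    then show ?thesis by metis
  qed
  have variation: "{(prob_Ypot P' False True, prob_Ypot P' True True) | P'. P' \<in> M \<and> same_observed K P' P} =
       {prob_Ypot P' False True | P'. P' \<in> M \<and> same_observed K P' P} \<times>
       {prob_Ypot P' True True | P'. P' \<in> M \<and> same_observed K P' P}"
    using pair by fast
  \<comment> \<open>The margins attaining the lower bound for the causal effect attain two of the four bounds
    on response probabilities as well; the margins for the upper bound attain the other two.\<close>
  have low: "\<exists>P'\<in>M. same_observed K P' P \<and> prob_Ypot P' False True = ?g False True \<and>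
      prob_Ypot P' True True = 1 - ?g True False"
    by (rule realise) (use g_sum[of False] g_sum[of True] in auto)
  have high: "\<exists>P'\<in>M. same_observed K P' P \<and> prob_Ypot P' False True = 1 - ?g False False \<and>
      prob_Ypot P' True True = ?g True True"
    by (rule realise) (use g_sum[of False] g_sum[of True] in auto)
  have attained: "\<exists>P'\<in>M. same_observed K P' P \<and> prob_Ypot P' i j = ?g i j" for i j
  proof (cases "i = j")
    case True
    then show ?thesis using high sum by (cases i) fastforce+
  next
    case False
    then show ?thesis using low sum by (cases i) fastforce+
  qed
  have "1 - ?g True False - ?g False True \<le> ACE P" "ACE P \<le> ?g False False + ?g True True - 1"
    using bound[OF assms(4) self] sum[of P] unfolding ACE_def by (smt (verit))+
  moreover have "\<exists>P'\<in>M. same_observed K P' P \<and> ACE P' = 1 - ?g True False - ?g False True"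
    using low unfolding ACE_def by fastforce
  moreover have "\<exists>P'\<in>M. same_observed K P' P \<and> ACE P' = ?g False False + ?g True True - 1"
    using high unfolding ACE_def by fastforce
  ultimately show ?thesis
    using bound[OF assms(4) self] variation attained by blast
qed

end
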